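(* Assume $\mathrm{Rank}(\mathbf{X}) \geq d$. Then the mean squared error of the compressed least squares estimator $\hat{\beta}_d^{\phi}$ satisfies $$\mathbb{E}_{\phi}\big[\mathbb{E}_{\varepsilon}[\|\mathbf{X} \beta -\mathbf{X} \hat{\beta}_d^{\phi} \|_2^2]\big] \leq \sigma^2 d +\sum_{i=1}^p \beta_i^2 \lambda_i w_i ,$$ where, for $i=1,\dots,p$, $$w_i = \frac{(1+1/d)\lambda_i^2+(1+2/d)\lambda_i \operatorname{trace}(\Sigma)+\operatorname{trace}(\Sigma)^2/d}{(d+2+1/d)\lambda_i^2+2(1+1/d)\lambda_i \operatorname{trace}(\Sigma)+\operatorname{trace}(\Sigma)^2/d}.$$
   Context: Fixed design linear model: $\mathbf{X}\in\mathbb{R}^{n\times p}$ is a deterministic matrix, $\beta\in\mathbb{R}^p$ a fixed vector, and $\mathbf{Y}=\mathbf{X}\beta+\varepsilon$, where $\varepsilon\in\mathbb{R}^n$ is i.i.d. noise with $\mathbb{E}_\varepsilon[\varepsilon]=0$ and $\mathbb{E}_\varepsilon[\varepsilon\varepsilon']=\sigma^2 I_{n\times n}$. The coordinates are chosen so that the Gram matrix is diagonal: $\Sigma=\mathbf{X}'\mathbf{X}=\mathrm{diag}(\lambda_1,\dots,\lambda_p)$. Here $d\ge 1$ is an integer and $\phi\in\mathbb{R}^{p\times d}$ is a random projection, i.e. a random matrix with i.i.d. $\mathcal{N}(0,1/d)$ entries, independent of $\varepsilon$. The compressed least squares estimator is $$\hat{\beta}_d^{\phi}=\phi\,\operatorname{argmin}_{\gamma\in\mathbb{R}^d}\|\mathbf{Y}-\mathbf{X}\phi\gamma\|_2^2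 = \phi(\phi'\mathbf{X}'\mathbf{X}\phi)^{-1}\phi'\mathbf{X}'\mathbf{Y}$$ (under the rank hypothesis, $\phi'\mathbf{X}'\mathbf{X}\phi$ is invertible almost surely). $\mathbb{E}_\phi$ and $\mathbb{E}_\varepsilon$ denote expectation over $\phi$ and $\varepsilon$ respectively, and a prime denotes transpose. *)

theory Defs
  imports "HOL-Probability.Probability"
begin

text \<open>
  Vectors and matrices are indexed by finite types: a matrix with \<open>n\<close> rows and \<open>p\<close> columns has
  type \<open>real^'p^'n\<close>, and the projection dimension \<open>d\<close> is \<open>CARD('d)\<close>.
\<close>

definition diag_mat :: "real^'p \<Rightarrow> real^'p^'p" where
  "diag_mat v = (\<chi> i j. if i = j then v $ i else 0)"

definition outer_prod :: "real^'n \<Rightarrow> real^'m \<Rightarrow> real^'m^'n" where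
  "outer_prod u v = (\<chi> i j. u $ i * v $ j)"

text \<open>
  The minimiser need not be unique when \<open>X ** \<phi>\<close> is not injective; \<open>arg_min\<close> then picks some
  minimiser, and the fitted vector \<open>X *v compressed_ls X \<phi> Y\<close> does not depend on the choice.
\<close>

definition compressed_ls :: "real^'p^'n \<Rightarrow> real^'d^'p \<Rightarrow> real^'n \<Rightarrow> real^'p" where
  "compressed_ls X \<phi> Y =
     \<phi> *v arg_min (\<lambda>\<gamma>. (norm (Y - (X ** \<phi>) *v \<gamma>))\<^sup>2) (\<lambda>_. True)"

lemma compressed_ls_closed_form:
  fixes X :: "real^'p^'n" and \<phi> :: "real^'d^'p" and Y :: "real^'n"
  assumes inv: "invertible (transpose \<phi> ** transpose X ** X ** \<phi>)"
  shows "compressed_ls X \<phi> Y =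
    (\<phi> ** matrix_inv (transpose \<phi> ** transpose X ** X ** \<phi>) ** transpose \<phi> ** transpose X) *v Y"
proof -
  define A where "A = X ** \<phi>"
  define G where "G = transpose A ** A"
  have G: "transpose \<phi> ** transpose X ** X ** \<phi> = G"
    by (simp add: G_def A_def matrix_transpose_mul matrix_mul_assoc)
  have "\<exists>B. G ** B = mat 1 \<and> B ** G = mat 1"
    using inv G by (simp add: invertible_def)
  then have invG: "G ** matrix_inv G = mat 1 \<and> matrix_inv G ** G = mat 1"
    unfolding matrix_inv_def by (rule someI_ex)
  define \<gamma>0 where "\<gamma>0 = (matrix_inv G ** transpose A) *v Y"
  let ?f = "\<lambda>\<gamma>. (norm (Y - A *v \<gamma>))\<^sup>2"
  have "G *v \<gamma>0 = (G ** matrix_inv G) *v (transpose A *v Y)"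
    by (simp add: \<gamma>0_def matrix_vector_mul_assoc matrix_mul_assoc del: transpose_matrix_vector)
  also have "\<dots> = transpose A *v Y"
    using invG by (simp del: transpose_matrix_vector)
  finally have normal_eq: "transpose A *v (Y - A *v \<gamma>0) = 0"
    by (simp add: matrix_vector_mult_diff_distrib G_def matrix_vector_mul_assoc del: transpose_matrix_vector)
  have pyth: "?f \<gamma> = ?f \<gamma>0 + (norm (A *v (\<gamma> - \<gamma>0)))\<^sup>2" for \<gamma>
  proof -
    have orth: "(Y - A *v \<gamma>0) \<bullet> (A *v (\<gamma> - \<gamma>0)) = 0"
      using normal_eq by (metis dot_lmul_matrix inner_zero_left transpose_matrix_vector)
    have "Y - A *v \<gamma> = (Y - A *v \<gamma>0) - A *v (\<gamma> - \<gamma>0)"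
      by (simp add: matrix_vector_mult_diff_distrib)
    then have "?f \<gamma> = (norm ((Y - A *v \<gamma>0) - A *v (\<gamma> - \<gamma>0)))\<^sup>2"
      by (simp only:)
    also have "\<dots> = ?f \<gamma>0 + (norm (A *v (\<gamma> - \<gamma>0)))\<^sup>2"
      using orth unfolding power2_norm_eq_inner
      by (simp only: inner_diff_left inner_diff_right inner_commute)
    finally show ?thesis .
  qed
  have "?f \<gamma>0 \<le> ?f \<gamma>" for \<gamma>
    by (metis pyth le_add_same_cancel1 zero_le_power2)
  then have "is_arg_min ?f (\<lambda>_. True) \<gamma>0"
    unfolding is_arg_min_def by (meson not_less)
  then have am: "is_arg_min ?f (\<lambda>_. True) (arg_min ?f (\<lambda>_. True))"
    unfolding arg_min_def by (rule someI)
  define \<gamma>1 where "\<gamma>1 = arg_min ?f (\<lambda>_. True)"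
  have "\<not> ?f \<gamma>0 < ?f \<gamma>1"
    using am unfolding \<gamma>1_def is_arg_min_def by blast
  then have "A *v (\<gamma>1 - \<gamma>0) = 0" using pyth[of \<gamma>1] by simp
  then have "G *v (\<gamma>1 - \<gamma>0) = 0"
    by (simp add: G_def flip: matrix_vector_mul_assoc)
  then have "(matrix_inv G ** G) *v (\<gamma>1 - \<gamma>0) = 0"
    by (simp flip: matrix_vector_mul_assoc)
  then have "\<gamma>1 = \<gamma>0" using invG by simp
  then show ?thesis
    unfolding compressed_ls_def G \<gamma>1_def A_def[symmetric]
    by (simp add: \<gamma>0_def A_def matrix_transpose_mul matrix_vector_mul_assoc matrix_mul_assoc)
qed

text \<open>The arguments are an eigenvalue \<open>l\<close>, the trace \<open>t\<close> and the projection dimension \<open>d\<close>.\<close>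

definition shrink_weight :: "real \<Rightarrow> real \<Rightarrow> real \<Rightarrow> real" where
  "shrink_weight l t d =
     ((1 + 1/d) * l\<^sup>2 + (1 + 2/d) * l * t + t\<^sup>2 / d) /
     ((d + 2 + 1/d) * l\<^sup>2 + 2 * (1 + 1/d) * l * t + t\<^sup>2 / d)"

end

theory Submission
  imports Defs
begin

text \<open>
  For a fixed \<open>\<phi>\<close> the fitted vector is the orthogonal projection of \<open>Y\<close> onto the range of \<open>X ** \<phi>\<close>,
  so the risk splits into a variance term, at most \<open>\<sigma>\<^sup>2 d\<close> because the range has dimension at most
  \<open>d\<close>, and the squared distance of \<open>X *v \<beta>\<close> to the range. The latter is at most the squared
  distance to \<open>X \<phi> \<phi>' v\<close> for any deterministic \<open>v\<close>. Its expectation over \<open>\<phi>\<close> is quadratic in \<open>v\<close>,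
  with coefficients given by the fourth moments of independent normals, and separates over the
  coordinates; its minimiser \<open>v\<^sub>i = \<beta>\<^sub>i \<lambda>\<^sub>i / ((1 + 1/d) \<lambda>\<^sub>i + trace \<Sigma> / d)\<close> yields the weights.
\<close>

section \<open>Least squares as orthogonal projection\<close>

text \<open>Let \<open>P\<close> be the orthogonal projection onto the range of
  \<open>X ** A\<close>. Then \<open>f - P (f + e)\<close> is the sum of \<open>f - P f\<close>,
  orthogonal to the range, and \<open>- P e\<close>, inside it, so bias and noise separate by
  Pythagoras. The noise term is expanded over an orthonormal basis so that its expectation can be
  taken one direction at a time. If \<open>X ** A\<close> is not injective, this basis has fewer
  than \<open>CARD('d)\<close> elements.\<close>

lemma compressed_ls_orthonormal_basis:
  fixes X :: "real^'p^'n" and A :: "real^'d^'p"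
  obtains B where "finite B" "card B \<le> CARD('d)" "\<And>b. b \<in> B \<Longrightarrow> norm b = 1"
    and "\<And>f e. (norm (f - X *v compressed_ls X A (f + e)))\<^sup>2
           = (norm (f - X *v compressed_ls X A f))\<^sup>2 + (\<Sum>b\<in>B. (e \<bullet> b)\<^sup>2)"
    and "\<And>f \<gamma>. norm (f - X *v compressed_ls X A f) \<le> norm (f - (X ** A) *v \<gamma>)"
proof -
  define S where "S = range (\<lambda>\<gamma>. (X ** A) *v \<gamma>)"
  have "subspace S"
    unfolding S_def by (intro linear_subspace_image) auto
  then obtain B where B: "B \<subseteq> S" "pairwise orthogonal B" "\<And>b. b \<in> B \<Longrightarrow> norm b = 1"
    "independent B" "card B = dim S" "span B = S"
    by (rule orthonormal_basis_subspace) blast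
  have fin: "finite B"
    using B(4) by (rule independent_imp_finite)
  have card: "card B \<le> CARD('d)"
    using rank_bound[of "X ** A"] B(5) by (simp add: S_def rank_dim_range)
  define P where "P y = (\<Sum>b\<in>B. (y \<bullet> b) *\<^sub>R b)" for y
  have inner_B: "b \<bullet> c = of_bool (b = c)" if "b \<in> B" "c \<in> B" for b c
    using that B(2,3) by (auto simp: pairwise_def orthogonal_def norm_eq_1)
  have P_S: "P y \<in> S" for y
    unfolding P_def B(6)[symmetric] by (intro span_sum span_scale span_base)
  have P_inner: "P y \<bullet> c = y \<bullet> c" if "c \<in> B" for y c
  proof -
    have "P y \<bullet> c = (\<Sum>b\<in>B. (y \<bullet> b) * of_bool (b = c))"
      unfolding P_def inner_sum_left using that by (intro sum.cong) (simp_all add: inner_B)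
    also have "\<dots> = y \<bullet> c"
      using fin that by (simp add: of_bool_def if_distrib sum.delta cong: if_cong)
    finally show ?thesis .
  qed
  have orth: "(y - P y) \<bullet> s = 0" if "s \<in> S" for y s
  proof -
    have "orthogonal (y - P y) s"
      using that[folded B(6)]
      by (rule orthogonal_to_span) (simp add: orthogonal_def inner_diff_left P_inner)
    then show ?thesis by (simp add: orthogonal_def)
  qed
  have pyth: "(norm (y - s))\<^sup>2 = (norm (y - P y))\<^sup>2 + (norm (P y - s))\<^sup>2" if "s \<in> S" for y s
  proof -
    have "P y - s \<in> S"
      using \<open>subspace S\<close> P_S that by (rule subspace_diff)
    then have "(y - P y) \<bullet> (P y - s) = 0"
      by (rule orth)
    then show ?thesis
      using norm_add_Pythagorean[of "y - P y" "P y - s"] by (simp add: orthogonal_def)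
  qed
  \<comment> \<open>\<open>arg_min\<close> returns an unspecified minimiser. By \<open>pyth\<close>,
    the excess of any \<open>\<gamma>\<close> over a coefficient \<open>\<gamma>0\<close>
    representing \<open>P y\<close> is the squared distance from \<open>P y\<close> to the fit of
    \<open>\<gamma>\<close>. It vanishes at every minimiser, so all of them give the same
    fit.\<close>
  have fit: "X *v compressed_ls X A y = P y" for y
  proof -
    let ?f = "\<lambda>\<gamma>. (norm (y - (X ** A) *v \<gamma>))\<^sup>2"
    obtain \<gamma>0 where \<gamma>0: "P y = (X ** A) *v \<gamma>0"
      using P_S[of y] unfolding S_def by blast
    have f: "?f \<gamma> = ?f \<gamma>0 + (norm (P y - (X ** A) *v \<gamma>))\<^sup>2" for \<gamma>
      unfolding \<gamma>0[symmetric] by (rule pyth) (simp add: S_def)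
    have "is_arg_min ?f (\<lambda>_. True) \<gamma>0"
      unfolding is_arg_min_def using f by (metis le_add_same_cancel1 not_less zero_le_power2)
    then have am: "is_arg_min ?f (\<lambda>_. True) (arg_min ?f (\<lambda>_. True))"
      unfolding arg_min_def by (rule someI)
    define \<gamma>1 where "\<gamma>1 = arg_min ?f (\<lambda>_. True)"
    have "\<not> ?f \<gamma>0 < ?f \<gamma>1"
      using am unfolding \<gamma>1_def is_arg_min_def by blast
    then have "P y = (X ** A) *v \<gamma>1"
      using f[of \<gamma>1] by simp
    then show ?thesis
      by (simp add: compressed_ls_def \<gamma>1_def matrix_vector_mul_assoc)
  qed
  have norm_P: "(norm (P y))\<^sup>2 = (\<Sum>b\<in>B. (y \<bullet> b)\<^sup>2)" for y
  proof -
    have "(norm (P y))\<^sup>2 = (\<Sum>b\<in>B. (y \<bullet> b) * (P y \<bullet> b))"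
      unfolding power2_norm_eq_inner by (subst (2) P_def) (simp add: inner_sum_right)
    then show ?thesis
      by (simp add: P_inner power2_eq_square)
  qed
  have P_add: "P (y + z) = P y + P z" for y z
    by (simp add: P_def inner_add_left scaleR_add_left sum.distrib)
  show thesis
  proof
    show "(norm (f - X *v compressed_ls X A (f + e)))\<^sup>2
        = (norm (f - X *v compressed_ls X A f))\<^sup>2 + (\<Sum>b\<in>B. (e \<bullet> b)\<^sup>2)" for f e
      using pyth[OF P_S, of f "f + e"] norm_P[of e] by (simp add: fit P_add)
    show "norm (f - X *v compressed_ls X A f) \<le> norm (f - (X ** A) *v \<gamma>)" for f \<gamma>
    proof -
      have "(X ** A) *v \<gamma> \<in> S"
        by (simp add: S_def)
      from pyth[OF this, of f] show ?thesis
        unfolding fit by (metis le_add_same_cancel1 norm_ge_zero power2_le_imp_le zero_le_power2)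
    qed
  qed (use fin card B(3) in auto)
qed

section \<open>Moments of the noise and of independent normals\<close>

text \<open>Expanding the square gives the quadratic form of the second moment matrix at
  \<open>b\<close>. As this matrix is a multiple of the identity, all unit vectors contribute
  equally.\<close>

lemma has_bochner_integral_inner_sq:
  fixes \<epsilon> :: "'a \<Rightarrow> real^'n"
  assumes int: "integrable M (\<lambda>\<omega>. outer_prod (\<epsilon> \<omega>) (\<epsilon> \<omega>))"
    and cov: "(LINT \<omega>|M. outer_prod (\<epsilon> \<omega>) (\<epsilon> \<omega>)) = mat v"
  shows "has_bochner_integral M (\<lambda>\<omega>. (\<epsilon> \<omega> \<bullet> b)\<^sup>2) (v * (norm b)\<^sup>2)"
proof -
  \<comment> \<open>Reading off an entry is bounded linear, hence commutes with the Bochner integral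
    of the matrix-valued function.\<close>
  have bl: "bounded_linear (\<lambda>A :: real^'n^'n. A $ i $ j)" for i j
    by (intro bounded_linear_compose[OF bounded_linear_vec_nth] bounded_linear_vec_nth)
  have "has_bochner_integral M (\<lambda>\<omega>. outer_prod (\<epsilon> \<omega>) (\<epsilon> \<omega>)) (mat v)"
    using int cov by (simp add: has_bochner_integral_iff)
  from has_bochner_integral_bounded_linear[OF bl this]
  have ij: "has_bochner_integral M (\<lambda>\<omega>. \<epsilon> \<omega> $ i * \<epsilon> \<omega> $ j) (if i = j then v else 0)" for i j
    by (simp add: outer_prod_def mat_def)
  have "has_bochner_integral M (\<lambda>\<omega>. \<Sum>i\<in>UNIV. \<Sum>j\<in>UNIV. b $ i * b $ j * (\<epsilon> \<omega> $ i * \<epsilon> \<omega> $ j))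
      (\<Sum>i\<in>UNIV. \<Sum>j\<in>UNIV. b $ i * b $ j * (if i = j then v else 0))"
    by (intro has_bochner_integral_sum has_bochner_integral_mult_right ij)
  also have "(\<lambda>\<omega>. \<Sum>i\<in>UNIV. \<Sum>j\<in>UNIV. b $ i * b $ j * (\<epsilon> \<omega> $ i * \<epsilon> \<omega> $ j)) = (\<lambda>\<omega>. (\<epsilon> \<omega> \<bullet> b)\<^sup>2)"
    by (simp add: inner_vec_def power2_eq_square sum_product mult_ac)
  also have "(\<Sum>i\<in>UNIV. \<Sum>j\<in>UNIV. b $ i * b $ j * (if i = j then v else 0)) = v * (norm b)\<^sup>2"
    by (simp add: power2_norm_eq_inner inner_vec_def sum_distrib_left if_distrib mult_ac cong: if_cong)
  finally show ?thesis .
qed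

text \<open>These are the moments of a centred normal variable with standard deviation
  \<open>s\<close>; for even \<open>k\<close> the value is \<open>s ^ k\<close> times the product of
  the odd numbers below \<open>k\<close>. The quotient is left in the form of
  \<open>normal_moment_even\<close>.\<close>

definition normal_moment :: "real \<Rightarrow> nat \<Rightarrow> real" where
  "normal_moment s k =
     (if even k then fact k / ((2 / s\<^sup>2) ^ (k div 2) * fact (k div 2)) else 0)"

lemma distributed_normal_moment:
  assumes "distributed M lborel Z (normal_density 0 s)" and "0 < s"
  shows "has_bochner_integral M (\<lambda>\<omega>. Z \<omega> ^ k) (normal_moment s k)"
proof -
  have "has_bochner_integral lborel (\<lambda>x. normal_density 0 s x * x ^ k) (normal_moment s k)"
  proof (cases "even k")
    case True
    then show ?thesis
      using normal_moment_even[OF assms(2), of 0 "k div 2"] by (simp add: normal_moment_def)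
  next
    case False
    then have "2 * (k div 2) + 1 = k" by simp
    then show ?thesis
      using normal_moment_odd[OF assms(2), of 0 "k div 2"] False by (simp add: normal_moment_def)
  qed
  then show ?thesis
    using distributed_integrable[OF assms(1), of "\<lambda>x. x ^ k"]
      distributed_integral[OF assms(1), of "\<lambda>x. x ^ k"]
    by (simp add: has_bochner_integral_iff)
qed

lemma nn_integral_eq_has_bochner_integral:
  assumes "has_bochner_integral N f x" "\<And>\<omega>. 0 \<le> f \<omega>"
  shows "(\<integral>\<^sup>+\<omega>. ennreal (f \<omega>) \<partial>N) = ennreal (x :: real)"
  using assms by (simp add: has_bochner_integral_iff nn_integral_eq_integral)

context prob_space
begin

text \<open>Powers of independent variables are again independent, so the expectation of the product
  factorises.\<close>

lemma indep_normal_monomial: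
  fixes G :: "'i::finite \<Rightarrow> 'a \<Rightarrow> real"
  assumes indep: "indep_vars (\<lambda>_. borel) G UNIV"
    and normal: "\<And>i. distributed M lborel (G i) (normal_density 0 s)"
    and s: "0 < s"
  shows "has_bochner_integral M (\<lambda>\<omega>. \<Prod>i\<in>UNIV. G i \<omega> ^ n i) (\<Prod>i\<in>UNIV. normal_moment s (n i))"
proof -
  have indep': "indep_vars (\<lambda>_. borel) (\<lambda>i \<omega>. G i \<omega> ^ n i) UNIV"
    by (rule indep_vars_compose2[OF indep]) simp
  have "has_bochner_integral M (\<lambda>\<omega>. G i \<omega> ^ n i) (normal_moment s (n i))" for i
    using normal s by (rule distributed_normal_moment)
  then have "integrable M (\<lambda>\<omega>. G i \<omega> ^ n i)" "expectation (\<lambda>\<omega>. G i \<omega> ^ n i) = normal_moment s (n i)" for i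
    by (simp_all add: has_bochner_integral_iff)
  then show ?thesis
    using indep_vars_integrable[OF _ indep'] indep_vars_lebesgue_integral[OF _ indep']
    by (simp add: has_bochner_integral_iff)
qed

text \<open>The moments are sums over the pairings of the factors: one pairing for two factors,
  three for four. A pairing contributes only if the indices in each of its pairs agree.\<close>

lemma indep_normal_Isserlis:
  fixes G :: "'i::finite \<Rightarrow> 'a \<Rightarrow> real"
  assumes "indep_vars (\<lambda>_. borel) G UNIV"
    and "\<And>i. distributed M lborel (G i) (normal_density 0 s)"
    and s: "0 < s"
  shows indep_normal_second_moment:
      "has_bochner_integral M (\<lambda>\<omega>. G a \<omega> * G b \<omega>) (s\<^sup>2 * of_bool (a = b))"
    and indep_normal_fourth_moment:
      "has_bochner_integral M (\<lambda>\<omega>. G a \<omega> * G b \<omega> * (G c \<omega> * G d \<omega>))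
        (s ^ 4 * (of_bool (a = b \<and> c = d) + of_bool (a = c \<and> b = d) + of_bool (a = d \<and> b = c)))"
proof -
  note monomial = indep_normal_monomial[OF assms]
  have select: "(\<Prod>i\<in>UNIV. g i ^ of_bool (i = x)) = g x" for g :: "'i \<Rightarrow> real" and x
    by (simp add: of_bool_def if_distrib cong: if_cong)
  have m: "normal_moment s 0 = 1" "normal_moment s (Suc 0) = 0"
    "normal_moment s (Suc (Suc 0)) = s * s" "normal_moment s (Suc (Suc (Suc 0))) = 0"
    "normal_moment s (Suc (Suc (Suc (Suc 0)))) = 3 * (s * s * (s * s))"
    using s by (simp_all add: normal_moment_def fact_numeral field_simps power2_eq_square)
  have s4: "s ^ 4 = s * s * (s * s)"
    by (simp add: eval_nat_numeral)
  \<comment> \<open>The exponent of \<open>G i\<close> counts how often \<open>i\<close> occurs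
    among the factors, so coinciding indices are covered by the same monomial.\<close>
  let ?n = "\<lambda>i. of_bool (i = a) + of_bool (i = b) :: nat"
  have "(\<Prod>i\<in>UNIV. normal_moment s (?n i)) = (\<Prod>i\<in>{a, b}. normal_moment s (?n i))"
    by (rule prod.mono_neutral_right) (auto simp: m)
  also have "\<dots> = s\<^sup>2 * of_bool (a = b)"
    by (cases "a = b") (simp_all add: m power2_eq_square)
  finally show "has_bochner_integral M (\<lambda>\<omega>. G a \<omega> * G b \<omega>) (s\<^sup>2 * of_bool (a = b))"
    using monomial[of ?n] by (simp add: power_add prod.distrib select)
  let ?n = "\<lambda>i. of_bool (i = a) + of_bool (i = b) + (of_bool (i = c) + of_bool (i = d)) :: nat"
  have "(\<Prod>i\<in>UNIV. normal_moment s (?n i)) = (\<Prod>i\<in>{a, b, c, d}. normal_moment s (?n i))"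
    by (rule prod.mono_neutral_right) (auto simp: m)
  also have "\<dots> = s ^ 4 *
      (of_bool (a = b \<and> c = d) + of_bool (a = c \<and> b = d) + of_bool (a = d \<and> b = c))"
    \<comment> \<open>An index occurring an odd number of times makes both sides vanish. Two
      distinct pairs match exactly one pairing, and four equal indices match all three, in agreement
      with the fourth moment \<open>3 * s ^ 4\<close>.\<close>
    by (cases "a = b"; cases "a = c"; cases "a = d"; cases "b = c"; cases "b = d"; cases "c = d")
      (simp_all add: m s4 prod.insert_if)
  finally show "has_bochner_integral M (\<lambda>\<omega>. G a \<omega> * G b \<omega> * (G c \<omega> * G d \<omega>))
        (s ^ 4 * (of_bool (a = b \<and> c = d) + of_bool (a = c \<and> b = d) + of_bool (a = d \<and> b = c)))"
    using monomial[of ?n] by (simp add: power_add prod.distrib select)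
qed

section \<open>Moments of the random projection\<close>

text \<open>Here \<open>v v* \<phi> \<omega>\<close> is the transpose of
  \<open>\<phi> \<omega>\<close> applied to \<open>v\<close>. The entries have variance
  \<open>1/d\<close>, so the mean of \<phi>\<phi>' is the identity. In the second moment, pairing
  within each copy of \<phi>\<phi>' gives \<open>(v $ i)\<^sup>2\<close> for all
  \<open>d\<^sup>2\<close> pairs of columns. The two pairings across the copies force equal columns
  and give \<open>(norm v)\<^sup>2\<close> and \<open>(v $ i)\<^sup>2\<close> for each of the
  \<open>d\<close> columns.\<close>

lemma gaussian_projection_moments:
  fixes \<phi> :: "'a \<Rightarrow> real^'d^'p" and v :: "real^'p"
  assumes indep: "indep_vars (\<lambda>_. borel) (\<lambda>(i, j) \<omega>. \<phi> \<omega> $ i $ j) (UNIV :: ('p \<times> 'd) set)"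
    and normal: "\<And>i j. distributed M lborel (\<lambda>\<omega>. \<phi> \<omega> $ i $ j)
          (normal_density 0 (sqrt (1 / real CARD('d))))"
  shows "has_bochner_integral M (\<lambda>\<omega>. (\<phi> \<omega> *v (v v* \<phi> \<omega>)) $ i) (v $ i)"
    and "has_bochner_integral M (\<lambda>\<omega>. ((\<phi> \<omega> *v (v v* \<phi> \<omega>)) $ i)\<^sup>2)
        ((1 + 1 / real CARD('d)) * (v $ i)\<^sup>2 + (norm v)\<^sup>2 / real CARD('d))"
proof -
  define G where "G = (\<lambda>(i :: 'p, j :: 'd) \<omega>. \<phi> \<omega> $ i $ j)"
  define s where "s = sqrt (1 / real CARD('d))"
  have G: "indep_vars (\<lambda>_. borel) G UNIV" "\<And>x. distributed M lborel (G x) (normal_density 0 s)" "0 < s"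
    using indep normal by (auto simp: G_def s_def)
  have s2: "s\<^sup>2 = 1 / CARD('d)" and s4: "s ^ 4 = 1 / (real CARD('d))\<^sup>2"
    by (simp_all add: s_def power4_eq_xxxx power2_eq_square)
  have comp: "(\<phi> \<omega> *v (v v* \<phi> \<omega>)) $ i = (\<Sum>k\<in>UNIV. \<Sum>j\<in>UNIV. v $ j * (G (i, k) \<omega> * G (j, k) \<omega>))" for \<omega>
    by (simp add: matrix_vector_mult_def vector_matrix_mult_def G_def sum_distrib_left mult_ac)
  have "has_bochner_integral M (\<lambda>\<omega>. (\<phi> \<omega> *v (v v* \<phi> \<omega>)) $ i)
      (\<Sum>k\<in>(UNIV :: 'd set). \<Sum>j\<in>UNIV. v $ j * (s\<^sup>2 * of_bool ((i, k) = (j, k))))"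
    unfolding comp
    by (intro has_bochner_integral_sum has_bochner_integral_mult_right indep_normal_second_moment G)
  also have "(\<Sum>k\<in>(UNIV :: 'd set). \<Sum>j\<in>UNIV. v $ j * (s\<^sup>2 * of_bool ((i, k) = (j, k)))) = v $ i"
    by (simp add: s2 of_bool_def if_distrib cong: if_cong)
  finally show "has_bochner_integral M (\<lambda>\<omega>. (\<phi> \<omega> *v (v v* \<phi> \<omega>)) $ i) (v $ i)" .
  \<comment> \<open>The columns \<open>k\<close>, \<open>l\<close> and the rows \<open>j\<close>,
    \<open>m\<close> are the summation indices of the two copies of the coordinate.\<close>
  have sq: "((\<phi> \<omega> *v (v v* \<phi> \<omega>)) $ i)\<^sup>2 =
      (\<Sum>k\<in>UNIV. \<Sum>l\<in>UNIV. \<Sum>j\<in>UNIV. \<Sum>m\<in>UNIV. v $ j * v $ m *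
        (G (i, k) \<omega> * G (j, k) \<omega> * (G (i, l) \<omega> * G (m, l) \<omega>)))" for \<omega>
    unfolding comp power2_eq_square sum_product by (simp add: mult_ac)
  have "has_bochner_integral M (\<lambda>\<omega>. ((\<phi> \<omega> *v (v v* \<phi> \<omega>)) $ i)\<^sup>2)
      (\<Sum>k\<in>(UNIV :: 'd set). \<Sum>l\<in>(UNIV :: 'd set). \<Sum>j\<in>UNIV. \<Sum>m\<in>UNIV. v $ j * v $ m *
        (s ^ 4 * (of_bool ((i, k) = (j, k) \<and> (i, l) = (m, l)) + of_bool ((i, k) = (i, l) \<and> (j, k) = (m, l))
          + of_bool ((i, k) = (m, l) \<and> (j, k) = (i, l)))))"
    (is "has_bochner_integral _ _ ?S")
    unfolding sq
    by (intro has_bochner_integral_sum has_bochner_integral_mult_right indep_normal_fourth_moment G)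
  also have "?S = (\<Sum>k\<in>(UNIV :: 'd set). \<Sum>l\<in>(UNIV :: 'd set).
      s ^ 4 * ((v $ i)\<^sup>2 + of_bool (k = l) * ((norm v)\<^sup>2 + (v $ i)\<^sup>2)))"
  proof (intro sum.cong refl)
    fix k l :: 'd
    have *: "(\<Sum>j\<in>UNIV. \<Sum>m\<in>UNIV. v $ j * v $ m * of_bool (i = j \<and> i = m)) = (v $ i)\<^sup>2"
    proof -
      have "(\<Sum>j\<in>UNIV. \<Sum>m\<in>UNIV. v $ j * v $ m * of_bool (i = j \<and> i = m))
          = (\<Sum>j\<in>UNIV. v $ j * of_bool (i = j)) * (\<Sum>m\<in>UNIV. v $ m * of_bool (i = m))"
        unfolding sum_product by (intro sum.cong refl) auto
      also have "(\<Sum>j\<in>UNIV. v $ j * of_bool (i = j)) = v $ i"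
        by (simp add: of_bool_def if_distrib cong: if_cong)
      finally show ?thesis by (simp add: power2_eq_square)
    qed
    have **: "(\<Sum>j\<in>UNIV. \<Sum>m\<in>UNIV. v $ j * v $ m * of_bool (j = m)) = (norm v)\<^sup>2"
      by (simp add: power2_norm_eq_inner inner_vec_def of_bool_def if_distrib cong: if_cong)
    have cases: "(of_bool ((i, k) = (j, k) \<and> (i, l) = (m, l)) + of_bool ((i, k) = (i, l) \<and> (j, k) = (m, l))
          + of_bool ((i, k) = (m, l) \<and> (j, k) = (i, l)) :: real)
        = of_bool (i = j \<and> i = m) + of_bool (k = l) * (of_bool (j = m) + of_bool (i = j \<and> i = m))" for j m
      by (cases "k = l"; cases "i = j"; cases "i = m"; simp)
    have "(\<Sum>j\<in>UNIV. \<Sum>m\<in>UNIV. v $ j * v $ m *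
        (s ^ 4 * (of_bool ((i, k) = (j, k) \<and> (i, l) = (m, l)) + of_bool ((i, k) = (i, l) \<and> (j, k) = (m, l))
          + of_bool ((i, k) = (m, l) \<and> (j, k) = (i, l)))))
      = (\<Sum>j\<in>UNIV. \<Sum>m\<in>UNIV. s ^ 4 * (v $ j * v $ m * of_bool (i = j \<and> i = m)
          + of_bool (k = l) * (v $ j * v $ m * of_bool (j = m) + v $ j * v $ m * of_bool (i = j \<and> i = m))))"
      unfolding cases by (simp add: algebra_simps)
    also have "\<dots> = s ^ 4 * ((v $ i)\<^sup>2 + of_bool (k = l) * ((norm v)\<^sup>2 + (v $ i)\<^sup>2))"
      by (simp only: sum.distrib flip: sum_distrib_left) (simp only: * **)
    finally show "(\<Sum>j\<in>UNIV. \<Sum>m\<in>UNIV. v $ j * v $ m *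
        (s ^ 4 * (of_bool ((i, k) = (j, k) \<and> (i, l) = (m, l)) + of_bool ((i, k) = (i, l) \<and> (j, k) = (m, l))
          + of_bool ((i, k) = (m, l) \<and> (j, k) = (i, l)))))
      = s ^ 4 * ((v $ i)\<^sup>2 + of_bool (k = l) * ((norm v)\<^sup>2 + (v $ i)\<^sup>2))" .
  qed
  also have "\<dots> = s ^ 4 * ((real CARD('d))\<^sup>2 * (v $ i)\<^sup>2 + real CARD('d) * ((norm v)\<^sup>2 + (v $ i)\<^sup>2))"
    by (simp add: sum.distrib power2_eq_square flip: sum_distrib_left sum_distrib_right)
      (simp add: algebra_simps)
  also have "\<dots> = (1 + 1 / real CARD('d)) * (v $ i)\<^sup>2 + (norm v)\<^sup>2 / real CARD('d)"
    by (simp add: s4 field_simps power2_eq_square)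
  finally show "has_bochner_integral M (\<lambda>\<omega>. ((\<phi> \<omega> *v (v v* \<phi> \<omega>)) $ i)\<^sup>2)
        ((1 + 1 / real CARD('d)) * (v $ i)\<^sup>2 + (norm v)\<^sup>2 / real CARD('d))" .
qed

end

section \<open>Diagonal Gram matrix and the weights\<close>

lemma norm_matrix_vector_mult_diag_gram:
  fixes X :: "real^'p^'n"
  assumes "transpose X ** X = diag_mat lam"
  shows "(norm (X *v u))\<^sup>2 = (\<Sum>i\<in>UNIV. lam $ i * (u $ i)\<^sup>2)"
proof -
  have "(norm (X *v u))\<^sup>2 = u \<bullet> ((transpose X ** X) *v u)"
    unfolding power2_norm_eq_inner
    by (metis dot_lmul_matrix inner_commute matrix_vector_mul_assoc transpose_matrix_vector)
  also have "\<dots> = (\<Sum>i\<in>UNIV. lam $ i * (u $ i)\<^sup>2)"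
    unfolding assms
    by (simp add: inner_vec_def matrix_vector_mult_def diag_mat_def if_distrib if_distribR
        power2_eq_square mult_ac cong: if_cong)
  finally show ?thesis .
qed

text \<open>A diagonal entry of the Gram matrix is the squared norm of a column of
  \<open>X\<close>.\<close>

lemma diag_gram_nonneg:
  fixes X :: "real^'p^'n"
  assumes "transpose X ** X = diag_mat lam"
  shows "0 \<le> lam $ i"
proof -
  have "(norm (X *v axis i 1))\<^sup>2 = lam $ i"
    unfolding norm_matrix_vector_mult_diag_gram[OF assms]
    by (simp add: axis_def if_distrib[of "\<lambda>x. x\<^sup>2"] if_distrib[of "\<lambda>x. _ * x"] cong: if_cong)
  then show ?thesis
    by (metis zero_le_power2)
qed

text \<open>With \<open>D = (1 + 1 / d) * l + t / d\<close> the left side is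
  \<open>l * b\<^sup>2 - 2 * l * b * v + D * v\<^sup>2\<close>, and \<open>v = b * l / D\<close> is
  its minimiser, with value \<open>l * b\<^sup>2 * (1 - l / D)\<close>. The numerator and
  denominator of the weight factor as \<open>(l + t) * D\<close> and \<open>d * D\<^sup>2\<close>,
  and \<open>(l + t) / d = D - l\<close>, so the weight is \<open>1 - l / D\<close>.\<close>

lemma shrink_weight_eq_quadratic:
  fixes b l t d :: real
  assumes "0 \<le> l" "l \<le> t" "0 < d" and v: "v = b * l / ((1 + 1 / d) * l + t / d)"
  shows "l * b\<^sup>2 - 2 * l * b * v + (1 + 1 / d) * l * v\<^sup>2 + t / d * v\<^sup>2 = b\<^sup>2 * l * shrink_weight l t d"
proof (cases "l = 0")
  \<comment> \<open>Here \<open>v = 0\<close> even if the denominator of \<open>v\<close> is zero,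
    and the factor \<open>l\<close> removes the weight, which may be the quotient
    \<open>0 / 0\<close>.\<close>
  case True
  then show ?thesis using v by simp
next
  case False
  define D where "D = (1 + 1 / d) * l + t / d"
  have D: "D > 0"
    using assms False unfolding D_def by (intro add_pos_nonneg mult_pos_pos) simp_all
  have den: "(d + 2 + 1/d) * l\<^sup>2 + 2 * (1 + 1/d) * l * t + t\<^sup>2 / d = d * D\<^sup>2"
    using \<open>0 < d\<close> by (simp add: D_def field_simps power2_eq_square)
  have num: "(1 + 1/d) * l\<^sup>2 + (1 + 2/d) * l * t + t\<^sup>2 / d = (l + t) * D"
    using \<open>0 < d\<close> by (simp add: D_def field_simps power2_eq_square)
  have w: "shrink_weight l t d = (D - l) / D"
    unfolding shrink_weight_def den num using D \<open>0 < d\<close>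
    by (simp add: field_simps power2_eq_square) (simp add: D_def field_simps)
  have "l * b\<^sup>2 - 2 * l * b * v + (1 + 1 / d) * l * v\<^sup>2 + t / d * v\<^sup>2 = l * b\<^sup>2 - 2 * l * b * v + D * v\<^sup>2"
    by (simp add: D_def algebra_simps)
  also have "\<dots> = b\<^sup>2 * l * shrink_weight l t d"
    using D unfolding w v D_def[symmetric] by (simp add: field_simps power2_eq_square)
  finally show ?thesis .
qed

section \<open>Risk bound for the compressed estimator\<close>

theorem theorem2:
  fixes X :: "real^'p^'n" and \<beta> lam :: "real^'p" and \<sigma> :: real
    and M :: "'a measure"
    and \<phi> :: "'a \<Rightarrow> real^'d^'p" and \<epsilon> :: "'a \<Rightarrow> real^'n"
  assumes gram: "transpose X ** X = diag_mat lam"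
    and rank: "rank X \<ge> CARD('d)"
    and prob: "prob_space M"
    and phi_indep: "prob_space.indep_vars M (\<lambda>_. borel)
          (\<lambda>(i, j) \<omega>. \<phi> \<omega> $ i $ j) (UNIV :: ('p \<times> 'd) set)"
    and phi_normal: "\<And>i j. distributed M lborel (\<lambda>\<omega>. \<phi> \<omega> $ i $ j)
          (normal_density 0 (sqrt (1 / real CARD('d))))"
    and eps_indep: "prob_space.indep_vars M (\<lambda>_. borel) (\<lambda>i \<omega>. \<epsilon> \<omega> $ i) (UNIV :: 'n set)"
    and eps_ident: "\<And>i j. distr M borel (\<lambda>\<omega>. \<epsilon> \<omega> $ i) = distr M borel (\<lambda>\<omega>. \<epsilon> \<omega> $ j)"
    and eps_mean: "integrable M \<epsilon>" "prob_space.expectation M \<epsilon> = 0"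
    and eps_cov: "integrable M (\<lambda>\<omega>. outer_prod (\<epsilon> \<omega>) (\<epsilon> \<omega>))"
          "prob_space.expectation M (\<lambda>\<omega>. outer_prod (\<epsilon> \<omega>) (\<epsilon> \<omega>)) = mat (\<sigma>\<^sup>2)"
    and phi_eps_indep: "prob_space.indep_set M
          (sets (vimage_algebra (space M) \<phi> borel)) (sets (vimage_algebra (space M) \<epsilon> borel))"
  shows "(\<integral>\<^sup>+ A. (\<integral>\<^sup>+ e.
            ennreal ((norm (X *v \<beta> - X *v compressed_ls X A (X *v \<beta> + e)))\<^sup>2)
          \<partial>distr M borel \<epsilon>) \<partial>distr M borel \<phi>)
     \<le> ennreal (\<sigma>\<^sup>2 * real CARD('d)
          + (\<Sum>i\<in>UNIV. (\<beta> $ i)\<^sup>2 * lam $ i *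
               shrink_weight (lam $ i) (trace (transpose X ** X)) (real CARD('d))))"
proof -
  interpret prob_space M by (rule prob)
  define d where "d = real CARD('d)"
  define t where "t = trace (transpose X ** X)"
  have d: "0 < d" by (simp add: d_def)
  have lam: "0 \<le> lam $ i" for i
    using gram by (rule diag_gram_nonneg)
  have t: "t = (\<Sum>i\<in>UNIV. lam $ i)"
    by (simp add: t_def gram trace_def diag_mat_def)
  have lam_le: "lam $ i \<le> t" for i
    unfolding t using lam by (intro member_le_sum) auto
  define v :: "real^'p" where "v = (\<chi> i. \<beta> $ i * lam $ i / ((1 + 1 / d) * lam $ i + t / d))"
  \<comment> \<open>This is the squared distance from \<open>X *v \<beta>\<close> to the comparison
    vector with coefficient \<open>v v* A\<close>. As a polynomial in the entries of
    \<open>A\<close> it is continuous, hence measurable.\<close>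
  define h :: "real^'d^'p \<Rightarrow> real"
    where "h A = (\<Sum>i\<in>UNIV. lam $ i * (\<beta> $ i - (A *v (v v* A)) $ i)\<^sup>2)" for A
  have h: "(norm (X *v \<beta> - (X ** A) *v (v v* A)))\<^sup>2 = h A" for A
    using norm_matrix_vector_mult_diag_gram[OF gram, of "\<beta> - A *v (v v* A)"]
    by (simp add: h_def matrix_vector_mult_diff_distrib matrix_vector_mul_assoc)
  have h_nonneg: "0 \<le> h A" for A
    by (simp flip: h)
  have h_borel: "h \<in> borel_measurable borel"
    unfolding h_def matrix_vector_mult_def vector_matrix_mult_def
    by (intro borel_measurable_continuous_onI) (simp, intro continuous_intros)
  have \<epsilon>_borel: "\<epsilon> \<in> borel_measurable M"
    using eps_mean(1) by simp
  have \<phi>_borel: "\<phi> \<in> borel_measurable M"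
  proof (subst borel_measurable_euclidean_space, intro ballI)
    fix b :: "real^'d^'p" assume "b \<in> Basis"
    then obtain i j where b: "b = axis i (axis j 1)"
      by (auto simp: Basis_vec_def)
    have "(\<lambda>\<omega>. \<phi> \<omega> $ i $ j) \<in> borel_measurable M"
      using phi_normal[of i j] by (simp add: distributed_def)
    then show "(\<lambda>\<omega>. \<phi> \<omega> \<bullet> b) \<in> borel_measurable M"
      by (simp add: b inner_axis)
  qed
  have const: "has_bochner_integral M (\<lambda>_. c) c" for c :: real
    by (simp add: has_bochner_integral_iff prob_space)

  have norm_v: "(norm v)\<^sup>2 = (\<Sum>i\<in>UNIV. (v $ i)\<^sup>2)"
    by (simp add: power2_norm_eq_inner inner_vec_def flip: power2_eq_square)

  have conditional_risk: "(\<integral>\<^sup>+ e. ennreal ((norm (X *v \<beta> - X *v compressed_ls X A (X *v \<beta> + e)))\<^sup>2)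
      \<partial>distr M borel \<epsilon>) \<le> ennreal (\<sigma>\<^sup>2 * d + h A)" for A :: "real^'d^'p"
  proof -
    let ?bias = "(norm (X *v \<beta> - X *v compressed_ls X A (X *v \<beta>)))\<^sup>2"
    obtain B where B: "finite B" "card B \<le> CARD('d)" "\<And>b. b \<in> B \<Longrightarrow> norm b = 1"
      and decomp: "\<And>f e. (norm (f - X *v compressed_ls X A (f + e)))\<^sup>2
           = (norm (f - X *v compressed_ls X A f))\<^sup>2 + (\<Sum>b\<in>B. (e \<bullet> b)\<^sup>2)"
      and minimal: "\<And>f \<gamma>. norm (f - X *v compressed_ls X A f) \<le> norm (f - (X ** A) *v \<gamma>)"
      by (rule compressed_ls_orthonormal_basis[of X A]) blast
    have "has_bochner_integral M (\<lambda>\<omega>. ?bias + (\<Sum>b\<in>B. (\<epsilon> \<omega> \<bullet> b)\<^sup>2)) (?bias + (\<Sum>b\<in>B. \<sigma>\<^sup>2 * (norm b)\<^sup>2))"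
      by (intro has_bochner_integral_add const has_bochner_integral_sum has_bochner_integral_inner_sq eps_cov)
    also have "(\<Sum>b\<in>B. \<sigma>\<^sup>2 * (norm b)\<^sup>2) = \<sigma>\<^sup>2 * card B"
      using B(3) by simp
    finally have int: "(\<integral>\<^sup>+\<omega>. ennreal (?bias + (\<Sum>b\<in>B. (\<epsilon> \<omega> \<bullet> b)\<^sup>2)) \<partial>M) = ennreal (?bias + \<sigma>\<^sup>2 * card B)"
      by (rule nn_integral_eq_has_bochner_integral) (simp add: sum_nonneg)
    have "(\<integral>\<^sup>+ e. ennreal ((norm (X *v \<beta> - X *v compressed_ls X A (X *v \<beta> + e)))\<^sup>2) \<partial>distr M borel \<epsilon>)
        = ennreal (?bias + \<sigma>\<^sup>2 * card B)"
      \<comment> \<open>After \<open>decomp\<close> the integrand is an explicit quadratic in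
        \<open>e\<close>, so its measurability is evident and the integral can be moved to
        \<open>M\<close>.\<close>
      unfolding decomp using \<epsilon>_borel by (subst nn_integral_distr) (simp_all add: int)
    also have "\<dots> \<le> ennreal (\<sigma>\<^sup>2 * d + h A)"
    proof (rule ennreal_leI)
      \<comment> \<open>The least squares fit is compared with the coefficient
        \<open>v v* A\<close>.\<close>
      have "?bias \<le> h A"
        unfolding h[symmetric] by (intro power_mono minimal) simp
      moreover have "\<sigma>\<^sup>2 * card B \<le> \<sigma>\<^sup>2 * d"
        unfolding d_def using B(2) by (intro mult_left_mono) simp_all
      ultimately show "?bias + \<sigma>\<^sup>2 * card B \<le> \<sigma>\<^sup>2 * d + h A" by simp
    qed
    finally show ?thesis .
  qed

  have "has_bochner_integral M (\<lambda>\<omega>. (\<beta> $ i)\<^sup>2 - 2 * \<beta> $ i * (\<phi> \<omega> *v (v v* \<phi> \<omega>)) $ i + ((\<phi> \<omega> *v (v v* \<phi> \<omega>)) $ i)\<^sup>2)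
      ((\<beta> $ i)\<^sup>2 - 2 * \<beta> $ i * v $ i + ((1 + 1 / d) * (v $ i)\<^sup>2 + (norm v)\<^sup>2 / d))" for i
    unfolding d_def
    by (intro has_bochner_integral_add has_bochner_integral_diff has_bochner_integral_mult_right const
        gaussian_projection_moments[OF phi_indep phi_normal])
  then have "has_bochner_integral M (\<lambda>\<omega>. (\<beta> $ i - (\<phi> \<omega> *v (v v* \<phi> \<omega>)) $ i)\<^sup>2)
      ((\<beta> $ i)\<^sup>2 - 2 * \<beta> $ i * v $ i + ((1 + 1 / d) * (v $ i)\<^sup>2 + (norm v)\<^sup>2 / d))" for i
    by (simp add: power2_diff algebra_simps)
  then have "has_bochner_integral M (\<lambda>\<omega>. \<sigma>\<^sup>2 * d + h (\<phi> \<omega>)) (\<sigma>\<^sup>2 * d + (\<Sum>i\<in>UNIV. lam $ i *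
      ((\<beta> $ i)\<^sup>2 - 2 * \<beta> $ i * v $ i + ((1 + 1 / d) * (v $ i)\<^sup>2 + (norm v)\<^sup>2 / d))))"
    unfolding h_def
    by (intro has_bochner_integral_add const has_bochner_integral_sum has_bochner_integral_mult_right)
  also have "(\<Sum>i\<in>UNIV. lam $ i * ((\<beta> $ i)\<^sup>2 - 2 * \<beta> $ i * v $ i + ((1 + 1 / d) * (v $ i)\<^sup>2 + (norm v)\<^sup>2 / d)))
      = (\<Sum>i\<in>UNIV. lam $ i * (\<beta> $ i)\<^sup>2 - 2 * lam $ i * \<beta> $ i * v $ i + (1 + 1 / d) * lam $ i * (v $ i)\<^sup>2)
        + (\<Sum>i\<in>UNIV. lam $ i) * (norm v)\<^sup>2 / d"
    by (simp add: sum_distrib_right sum_divide_distrib algebra_simps flip: sum.distrib)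
  \<comment> \<open>The term \<open>(norm v)\<^sup>2 / d\<close> couples the coordinates, but summed
    against \<open>lam\<close> it only picks up the factor \<open>t\<close>. Distributing
    \<open>t / d\<close> over the squares of the coordinates of \<open>v\<close> leaves one
    quadratic per coordinate.\<close>
  also have "\<dots> = (\<Sum>i\<in>UNIV. lam $ i * (\<beta> $ i)\<^sup>2 - 2 * lam $ i * \<beta> $ i * v $ i + (1 + 1 / d) * lam $ i * (v $ i)\<^sup>2
        + t / d * (v $ i)\<^sup>2)"
    unfolding t[symmetric] norm_v sum.distrib by (simp add: sum_distrib_left sum_divide_distrib)
  also have "\<dots> = (\<Sum>i\<in>UNIV. (\<beta> $ i)\<^sup>2 * lam $ i * shrink_weight (lam $ i) t d)"
    using lam lam_le d by (intro sum.cong refl shrink_weight_eq_quadratic) (simp_all add: v_def)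
  finally have mean: "(\<integral>\<^sup>+\<omega>. ennreal (\<sigma>\<^sup>2 * d + h (\<phi> \<omega>)) \<partial>M) =
      ennreal (\<sigma>\<^sup>2 * d + (\<Sum>i\<in>UNIV. (\<beta> $ i)\<^sup>2 * lam $ i * shrink_weight (lam $ i) t d))"
    using d h_nonneg by (intro nn_integral_eq_has_bochner_integral) simp_all

  \<comment> \<open>Monotonicity of the nonnegative integral holds for arbitrary integrands, so
    measurability in \<open>A\<close> is only used for the bound \<open>h\<close>.\<close>
  have "(\<integral>\<^sup>+ A. (\<integral>\<^sup>+ e. ennreal ((norm (X *v \<beta> - X *v compressed_ls X A (X *v \<beta> + e)))\<^sup>2)
      \<partial>distr M borel \<epsilon>) \<partial>distr M borel \<phi>) \<le> (\<integral>\<^sup>+ A. ennreal (\<sigma>\<^sup>2 * d + h A) \<partial>distr M borel \<phi>)"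
    by (intro nn_integral_mono conditional_risk)
  also have "\<dots> = (\<integral>\<^sup>+\<omega>. ennreal (\<sigma>\<^sup>2 * d + h (\<phi> \<omega>)) \<partial>M)"
    using \<phi>_borel h_borel by (subst nn_integral_distr) simp_all
  also note mean
  finally show ?thesis
    unfolding d_def t_def .
qed

end
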